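(* Let $G$ be a countably infinite group. Every expansive action $G\curvearrowright X$ on a compact metrizable space by homeomorphisms with the topological Markov property has the uniform topological Markov property.
   Context: Fix a compatible metric $d$ on $X$ (the notions below do not depend on its choice). For $K\subset G$ and $x,y\in X$ write $d_K(x,y)=\sup_{g\in K}d(gx,gy)$. Expansive: there is $c>0$ such that for all $x\neq y$ in $X$ there is $g\in G$ with $d(gx,gy)>c$. Memory set: for $\varepsilon,\delta>0$ and finite $A\subset B\subset G$, $B$ is an $(\varepsilon,\delta)$-memory set for $A$ if for every $x,y\in X$ with $d_{B\setminus A}(x,y)\le\delta$ there is $z\in X$ with $d_B(x,z)\le\varepsilon$ and $d_{G\setminus A}(y,z)\le\varepsilon$. A set $V\subset G$ is $B$-separated if $Bv_1\cap Bv_2=\varnothing$ for all distinct $v_1,v_2\in V$. An $(\varepsilon,\delta)$-memory set $B$ for $A$ is uniform if for every finite $B$-separated $V\subset G$, all $x_v\in X$ ($v\in V$) and $y\in X$ with $d_{(B\setminus A)v}(x_v,y)\le\delta$ for every $v\in V$, there is $z\in X$ with $d_{Bv}(z,x_v)\le\varepsilon$ for every $v\in V$ and $d_{G\setminus AV}(z,y)\le\varepsilon$. Topological Markov property (resp. uniform topological Markov property): for every $\varepsilon>0$ there is $\delta>0$ such that every finite $A\subset G$ admits an $(\varepsilon,\delta)$-memory set (resp. a uniform $(\varepsilon,\delta)$-memory set). *)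

theory Defs
  imports "HOL-Analysis.Abstract_Metric_Spaces" "HOL-Algebra.Group_Action"
begin

text \<open>Here \<open>d\<close> is a metric on \<open>X\<close> and \<open>\<phi> g x\<close> is the action \<open>g x\<close> of \<open>g\<close> on \<open>x\<close>.\<close>

text \<open>
  The supremum is taken in \<open>[0, \<infinity>)\<close>: inserting \<open>0\<close> changes nothing for nonempty \<open>K\<close> and gives \<open>0\<close>
  for \<open>K = {}\<close>. The distances are bounded, as required for a meaningful real supremum, whenever
  the space is compact.
\<close>
definition dist_on :: "('x \<Rightarrow> 'x \<Rightarrow> real) \<Rightarrow> ('g \<Rightarrow> 'x \<Rightarrow> 'x) \<Rightarrow> 'g set \<Rightarrow> 'x \<Rightarrow> 'x \<Rightarrow> real" where
  "dist_on d \<phi> K x y = Sup (insert 0 ((\<lambda>g. d (\<phi> g x) (\<phi> g y)) ` K))"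

definition expansive ::
  "('g, 'b) monoid_scheme \<Rightarrow> 'x set \<Rightarrow> ('x \<Rightarrow> 'x \<Rightarrow> real) \<Rightarrow> ('g \<Rightarrow> 'x \<Rightarrow> 'x) \<Rightarrow> bool" where
  "expansive G X d \<phi> \<longleftrightarrow>
     (\<exists>c>0. \<forall>x\<in>X. \<forall>y\<in>X. x \<noteq> y \<longrightarrow> (\<exists>g\<in>carrier G. d (\<phi> g x) (\<phi> g y) > c))"

definition memory_set ::
  "('g, 'b) monoid_scheme \<Rightarrow> 'x set \<Rightarrow> ('x \<Rightarrow> 'x \<Rightarrow> real) \<Rightarrow> ('g \<Rightarrow> 'x \<Rightarrow> 'x) \<Rightarrow>
    real \<Rightarrow> real \<Rightarrow> 'g set \<Rightarrow> 'g set \<Rightarrow> bool" where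
  "memory_set G X d \<phi> \<epsilon> \<delta> A B \<longleftrightarrow>
     finite B \<and> A \<subseteq> B \<and> B \<subseteq> carrier G \<and>
     (\<forall>x\<in>X. \<forall>y\<in>X. dist_on d \<phi> (B - A) x y \<le> \<delta> \<longrightarrow>
        (\<exists>z\<in>X. dist_on d \<phi> B x z \<le> \<epsilon> \<and> dist_on d \<phi> (carrier G - A) y z \<le> \<epsilon>))"

definition separated :: "('g, 'b) monoid_scheme \<Rightarrow> 'g set \<Rightarrow> 'g set \<Rightarrow> bool" where
  "separated G B V \<longleftrightarrow>
     (\<forall>v\<in>V. \<forall>w\<in>V. v \<noteq> w \<longrightarrow> (B #>\<^bsub>G\<^esub> v) \<inter> (B #>\<^bsub>G\<^esub> w) = {})"

definition uniform_memory_set ::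
  "('g, 'b) monoid_scheme \<Rightarrow> 'x set \<Rightarrow> ('x \<Rightarrow> 'x \<Rightarrow> real) \<Rightarrow> ('g \<Rightarrow> 'x \<Rightarrow> 'x) \<Rightarrow>
    real \<Rightarrow> real \<Rightarrow> 'g set \<Rightarrow> 'g set \<Rightarrow> bool" where
  "uniform_memory_set G X d \<phi> \<epsilon> \<delta> A B \<longleftrightarrow>
     memory_set G X d \<phi> \<epsilon> \<delta> A B \<and>
     (\<forall>V x y. finite V \<and> V \<subseteq> carrier G \<and> separated G B V \<and> (\<forall>v\<in>V. x v \<in> X) \<and> y \<in> X \<and>
        (\<forall>v\<in>V. dist_on d \<phi> ((B - A) #>\<^bsub>G\<^esub> v) (x v) y \<le> \<delta>) \<longrightarrow>
        (\<exists>z\<in>X. (\<forall>v\<in>V. dist_on d \<phi> (B #>\<^bsub>G\<^esub> v) z (x v) \<le> \<epsilon>) \<and>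
               dist_on d \<phi> (carrier G - (A <#>\<^bsub>G\<^esub> V)) z y \<le> \<epsilon>))"

definition topological_Markov_property ::
  "('g, 'b) monoid_scheme \<Rightarrow> 'x set \<Rightarrow> ('x \<Rightarrow> 'x \<Rightarrow> real) \<Rightarrow> ('g \<Rightarrow> 'x \<Rightarrow> 'x) \<Rightarrow> bool" where
  "topological_Markov_property G X d \<phi> \<longleftrightarrow>
     (\<forall>\<epsilon>>0. \<exists>\<delta>>0. \<forall>A. finite A \<and> A \<subseteq> carrier G \<longrightarrow> (\<exists>B. memory_set G X d \<phi> \<epsilon> \<delta> A B))"

definition uniform_topological_Markov_property ::
  "('g, 'b) monoid_scheme \<Rightarrow> 'x set \<Rightarrow> ('x \<Rightarrow> 'x \<Rightarrow> real) \<Rightarrow> ('g \<Rightarrow> 'x \<Rightarrow> 'x) \<Rightarrow> bool" where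
  "uniform_topological_Markov_property G X d \<phi> \<longleftrightarrow>
     (\<forall>\<epsilon>>0. \<exists>\<delta>>0. \<forall>A. finite A \<and> A \<subseteq> carrier G \<longrightarrow>
        (\<exists>B. uniform_memory_set G X d \<phi> \<epsilon> \<delta> A B))"

end

theory Submission
  imports Defs
begin

text \<open>
  Points of \<open>V\<close> are processed one at a time, each time overwriting the current point near \<open>A v\<close> by
  means of the Markov property. Expansivity keeps the errors from accumulating: by compactness
  there is a finite \<open>F\<close> such that two points which are \<open>c\<close>-close on \<open>F g\<close> are \<open>\<eta>\<close>-close at \<open>g\<close>.
  So if \<open>B\<close> is a memory set enlarged by \<open>F\<close>, the accumulated error of the previous
  steps, as long as it is at most \<open>c\<close>, is in fact at most \<open>\<eta>\<close> wherever the next step needs it.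
\<close>

section \<open>Actions by continuous maps on a compact metric space\<close>

locale compact_metric_action =
  group_action G M \<phi> + Metric_space M d
  for G :: "('g, 'b) monoid_scheme" (structure) and M :: "'x set" and \<phi> d +
  assumes compact: "compact_space mtopology"
    and continuous: "g \<in> carrier G \<Longrightarrow> continuous_map mtopology mtopology (\<phi> g)"
begin

sublocale group G
  using group_hom by (simp add: group_hom_def)

lemma act_closed: "g \<in> carrier G \<Longrightarrow> x \<in> M \<Longrightarrow> \<phi> g x \<in> M"
  using element_image by blast

lemma act_triangle:
  "\<lbrakk>g \<in> carrier G; x \<in> M; y \<in> M; z \<in> M\<rbrakk> \<Longrightarrow>
    d (\<phi> g x) (\<phi> g z) \<le> d (\<phi> g x) (\<phi> g y) + d (\<phi> g y) (\<phi> g z)"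
  by (intro triangle act_closed)

text \<open>Compactness bounds \<open>d\<close> on \<open>M\<close>, so the supremum is that of a
  bounded set of reals; \<open>0 \<le> r\<close> takes care of the inserted \<open>0\<close>. All
  later estimates can therefore be made at single group elements.\<close>

lemma dist_on_le_iff:
  assumes "K \<subseteq> carrier G" "x \<in> M" "y \<in> M" "0 \<le> r"
  shows "dist_on d \<phi> K x y \<le> r \<longleftrightarrow> (\<forall>g\<in>K. d (\<phi> g x) (\<phi> g y) \<le> r)"
proof -
  obtain C where "\<forall>x\<in>M. \<forall>y\<in>M. d x y \<le> C"
    using compact compactin_imp_mbounded[of M]
    by (auto simp: compact_space_def mbounded_alt)
  then have "bdd_above (insert 0 ((\<lambda>g. d (\<phi> g x) (\<phi> g y)) ` K))"
    using assms act_closed by (auto intro!: bdd_aboveI2[of _ _ C])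
  then show ?thesis
    unfolding dist_on_def using assms(4) by (subst cSup_le_iff) auto
qed

section \<open>Expansivity on finite sets of group elements\<close>

lemma continuous_map_act_dist:
  assumes "g \<in> carrier G"
  shows "continuous_map (prod_topology mtopology mtopology) euclideanreal
    (\<lambda>p. d (\<phi> g (fst p)) (\<phi> g (snd p)))"
proof -
  have "continuous_map (prod_topology mtopology mtopology) (mtopology_of (metric (M, d)))
      (\<phi> g \<circ> fst)"
    "continuous_map (prod_topology mtopology mtopology) (mtopology_of (metric (M, d)))
      (\<phi> g \<circ> snd)"
    unfolding mtopology_of
    using continuous[OF assms] continuous_map_fst continuous_map_snd continuous_map_compose
    by blast+
  from continuous_map_mdist[OF this] show ?thesis
    by simp
qed

text \<open>By expansivity, the open sets of pairs separated by more than \<open>c\<close> at some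
  \<open>g\<close>, together with an open neighbourhood of the diagonal, cover the compact product
  of \<open>M\<close> with itself. The finitely many \<open>g\<close> of a subcover form
  \<open>F\<close>: a pair that is \<open>c\<close>-close on \<open>F\<close> can only lie in the
  neighbourhood. Adjoining \<open>\<one>\<close> is harmless and later ensures that translates by
  \<open>F\<close> of a set cover that set.\<close>

lemma expansive_finite:
  assumes exp: "\<And>x y. \<lbrakk>x \<in> M; y \<in> M; x \<noteq> y\<rbrakk> \<Longrightarrow> \<exists>g\<in>carrier G. c < d (\<phi> g x) (\<phi> g y)"
    and "0 < \<eta>"
  shows "\<exists>F. finite F \<and> F \<subseteq> carrier G \<and> \<one> \<in> F \<and>
    (\<forall>x\<in>M. \<forall>y\<in>M. (\<forall>f\<in>F. d (\<phi> f x) (\<phi> f y) \<le> c) \<longrightarrow> d x y \<le> \<eta>)"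
proof -
  let ?P = "prod_topology mtopology mtopology"
  define U where "U g = {p \<in> topspace ?P. d (\<phi> g (fst p)) (\<phi> g (snd p)) \<in> {c<..}}" for g
  \<comment> \<open>Distances are written through the action of \<open>\<one>\<close> so that
    \<open>continuous_map_act_dist\<close> yields openness of \<open>W\<close> as well as of
    \<open>U g\<close>.\<close>
  define W where "W = {p \<in> topspace ?P. d (\<phi> \<one> (fst p)) (\<phi> \<one> (snd p)) \<in> {..<\<eta>}}"
  have one: "\<phi> \<one> x = x" if "x \<in> M" for x
    using that by (metis id_eq_one restrict_apply')
  have "openin ?P (U g)" if "g \<in> carrier G" for g
    unfolding U_def by (rule openin_continuous_map_preimage[OF continuous_map_act_dist]) (use that in auto)
  moreover have "openin ?P W"
    unfolding W_def by (rule openin_continuous_map_preimage[OF continuous_map_act_dist]) auto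
  ultimately have "openin ?P V" if "V \<in> insert W (U ` carrier G)" for V
    using that by auto
  moreover have "topspace ?P \<subseteq> \<Union> (insert W (U ` carrier G))"
  proof
    fix p assume p: "p \<in> topspace ?P"
    show "p \<in> \<Union> (insert W (U ` carrier G))"
    proof (cases "fst p = snd p")
      case True
      with p \<open>0 < \<eta>\<close> show ?thesis by (auto simp: W_def one)
    next
      case False
      then show ?thesis using p exp[of "fst p" "snd p"] by (auto simp: U_def)
    qed
  qed
  moreover have "compactin ?P (topspace ?P)"
    using compact by (metis compact_space_def compact_space_prod_topology)
  ultimately obtain \<F> where \<F>: "finite \<F>" "\<F> \<subseteq> insert W (U ` carrier G)" "topspace ?P \<subseteq> \<Union> \<F>"
    using compactinD by metis
  then have "finite (\<F> - {W})" "\<F> - {W} \<subseteq> U ` carrier G"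
    by auto
  then obtain F where F: "finite F" "F \<subseteq> carrier G" "\<F> - {W} = U ` F"
    by (meson finite_subset_image)
  show ?thesis
  proof (intro exI[of _ "insert \<one> F"] conjI ballI impI)
    fix x y assume xy: "x \<in> M" "y \<in> M" "\<forall>f\<in>insert \<one> F. d (\<phi> f x) (\<phi> f y) \<le> c"
    then have "(x, y) \<in> topspace ?P" by simp
    with \<F>(3) obtain S where S: "S \<in> \<F>" "(x, y) \<in> S" by blast
    have "(x, y) \<notin> U f" if "f \<in> F" for f
      using xy(3) that by (auto simp: U_def)
    with S F(3) have "S = W" by blast
    with S(2) show "d x y \<le> \<eta>" using xy by (simp add: W_def one)
  qed (use F in auto)
qed

section \<open>Gluing along a separated set\<close>

text \<open>Induction on \<open>V\<close> works because each step ends with the bounds it started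
  from: overwriting at a new \<open>v\<close> costs \<open>\<epsilon>'\<close>, but expansivity
  first reduces the old error to \<open>\<eta>\<close> against any \<open>x w\<close> and to
  \<open>\<eta> + \<delta>\<close> against \<open>y\<close>. \<open>FB0\<close> permits this
  reduction on translates of \<open>B0\<close>, \<open>FFA\<close> at points outside
  \<open>A <#> V\<close> whose \<open>F\<close>-translates meet it. Closeness to \<open>x v\<close>
  is recorded on \<open>A\<close> only, since on \<open>B - A\<close> it follows from closeness to
  \<open>y\<close> at the cost of \<open>\<delta>\<close>.\<close>

lemma glue_along_separated:
  assumes F: "F \<subseteq> carrier G" "\<one> \<in> F"
    and expand: "\<And>x y. \<lbrakk>x \<in> M; y \<in> M; \<And>f. f \<in> F \<Longrightarrow> d (\<phi> f x) (\<phi> f y) \<le> c\<rbrakk> \<Longrightarrow> d x y \<le> \<eta>"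
    and mem: "\<And>x y. \<lbrakk>x \<in> M; y \<in> M; \<And>g. g \<in> B0 - A \<Longrightarrow> d (\<phi> g x) (\<phi> g y) \<le> \<delta>'\<rbrakk> \<Longrightarrow>
      \<exists>z\<in>M. (\<forall>g\<in>B0. d (\<phi> g x) (\<phi> g z) \<le> \<epsilon>') \<and> (\<forall>g\<in>carrier G - A. d (\<phi> g y) (\<phi> g z) \<le> \<epsilon>')"
    and AB: "A \<subseteq> B0" "B0 \<subseteq> carrier G" "B \<subseteq> carrier G"
    and FB0: "\<And>f b. \<lbrakk>f \<in> F; b \<in> B0\<rbrakk> \<Longrightarrow> f \<otimes> b \<in> B"
    and FFA: "\<And>f f' a. \<lbrakk>f \<in> F; f' \<in> F; a \<in> A\<rbrakk> \<Longrightarrow> f \<otimes> (inv f' \<otimes> a) \<in> B"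
    and bounds: "0 \<le> \<delta>" "0 \<le> \<eta>" "0 \<le> \<epsilon>'" "\<eta> + \<delta> \<le> \<delta>'" "\<epsilon>' + \<eta> + 2 * \<delta> \<le> c"
    and V: "finite V" "V \<subseteq> carrier G" "separated G B V"
    and xy: "\<And>v. v \<in> V \<Longrightarrow> x v \<in> M" "y \<in> M"
    and close: "\<And>v b. \<lbrakk>v \<in> V; b \<in> B - A\<rbrakk> \<Longrightarrow> d (\<phi> (b \<otimes> v) (x v)) (\<phi> (b \<otimes> v) y) \<le> \<delta>"
  shows "\<exists>z\<in>M. (\<forall>v\<in>V. \<forall>a\<in>A. d (\<phi> (a \<otimes> v) z) (\<phi> (a \<otimes> v) (x v)) \<le> \<epsilon>' + \<eta>) \<and>
    (\<forall>g\<in>carrier G - (A <#> V). d (\<phi> g z) (\<phi> g y) \<le> \<epsilon>' + \<eta> + \<delta>)"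
  using V xy close
proof (induction V rule: finite_induct)
  case empty
  then show ?case using bounds by (intro bexI[of _ y]) (auto simp: act_closed)
next
  case (insert v V)
  have sub: "B0 \<subseteq> B" using FB0[OF F(2)] AB(2) by (metis l_one subset_iff)
  have car: "v \<in> carrier G" "V \<subseteq> carrier G" "A \<subseteq> carrier G"
    using insert.prems AB by auto
  have disj: "b \<otimes> w = b' \<otimes> w' \<Longrightarrow> w = w'"
    if "b \<in> B" "b' \<in> B" "w \<in> insert v V" "w' \<in> insert v V" for b b' w w'
    using insert.prems(2) that unfolding separated_def r_coset_def by blast
  have "separated G B V" using insert.prems(2) by (simp add: separated_def)
  then obtain u where u: "u \<in> M"
    and uA: "\<And>w a. \<lbrakk>w \<in> V; a \<in> A\<rbrakk> \<Longrightarrow> d (\<phi> (a \<otimes> w) u) (\<phi> (a \<otimes> w) (x w)) \<le> \<epsilon>' + \<eta>"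
    and uy: "\<And>g. g \<in> carrier G - (A <#> V) \<Longrightarrow> d (\<phi> g u) (\<phi> g y) \<le> \<epsilon>' + \<eta> + \<delta>"
    using insert.IH insert.prems by auto
  \<comment> \<open>Applying \<open>expand\<close> to the translates \<open>\<phi> g p\<close> and
    \<open>\<phi> g q\<close> turns it into an estimate at \<open>g\<close> that needs
    \<open>c\<close>-closeness on \<open>F\<close> times \<open>g\<close> only.\<close>
  have local_close: "d (\<phi> g p) (\<phi> g q) \<le> \<eta>"
    if "g \<in> carrier G" "p \<in> M" "q \<in> M" "\<And>f. f \<in> F \<Longrightarrow> d (\<phi> (f \<otimes> g) p) (\<phi> (f \<otimes> g) q) \<le> c"
    for g p q
  proof (rule expand)
    show "d (\<phi> f (\<phi> g p)) (\<phi> f (\<phi> g q)) \<le> c" if "f \<in> F" for f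
      using that \<open>g \<in> carrier G\<close> \<open>p \<in> M\<close> \<open>q \<in> M\<close> \<open>\<And>f. f \<in> F \<Longrightarrow> _ f\<close> F(1)
      by (metis composition_rule subsetD)
  qed (use that act_closed in auto)
  \<comment> \<open>By separation, \<open>B #> w\<close> meets \<open>A <#> V\<close> only inside
    \<open>A #> w\<close>, and only for \<open>w\<close> in \<open>V\<close>. In particular
    \<open>B #> v\<close> avoids \<open>A <#> V\<close>, as \<open>v\<close> is new.\<close>
  have outside: "b \<otimes> w \<notin> A <#> V" if "b \<in> B" "w \<in> insert v V" "b \<in> A \<Longrightarrow> w \<notin> V" for b w
  proof
    assume "b \<otimes> w \<in> A <#> V"
    then obtain a w' where aw: "a \<in> A" "w' \<in> V" "b \<otimes> w = a \<otimes> w'"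
      unfolding set_mult_def by auto
    with disj[of b a w w'] that sub AB(1) have "w = w'" by auto
    with aw have "b = a"
      using that(1) AB(3) car by (metis right_cancel subsetD)
    with aw \<open>w = w'\<close> that show False by blast
  qed
  \<comment> \<open>For \<open>b\<close> in \<open>A\<close> this is the induction hypothesis.
    Otherwise the comparison passes through \<open>y\<close>, with total error
    \<open>\<epsilon>' + \<eta> + 2 * \<delta>\<close>; this is where that sum has to be at most
    \<open>c\<close>.\<close>
  have ux: "d (\<phi> (b \<otimes> w) u) (\<phi> (b \<otimes> w) (x w)) \<le> c" if "w \<in> V" "b \<in> B" for w b
  proof (cases "b \<in> A")
    case True
    then show ?thesis using uA[OF that(1) True] bounds by linarith
  next
    case False
    have c: "b \<otimes> w \<in> carrier G" using that car AB by auto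
    have "d (\<phi> (b \<otimes> w) u) (\<phi> (b \<otimes> w) y) \<le> \<epsilon>' + \<eta> + \<delta>"
      using outside[of b w] that False c by (intro uy) auto
    moreover have "d (\<phi> (b \<otimes> w) (x w)) (\<phi> (b \<otimes> w) y) \<le> \<delta>"
      using insert.prems(5)[of w b] that False by auto
    moreover have "x w \<in> M" using insert.prems(3) that by auto
    ultimately show ?thesis
      using act_triangle[OF c u \<open>y \<in> M\<close> \<open>x w \<in> M\<close>] bounds
        commute[of "\<phi> (b \<otimes> w) y" "\<phi> (b \<otimes> w) (x w)"] by linarith
  qed
  have ux': "d (\<phi> (h \<otimes> w) u) (\<phi> (h \<otimes> w) (x w)) \<le> \<eta>"
    if "w \<in> V" "h \<in> carrier G" "\<And>f. f \<in> F \<Longrightarrow> f \<otimes> h \<in> B" for w h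
  proof (rule local_close)
    fix f assume "f \<in> F"
    then have "f \<otimes> (h \<otimes> w) = (f \<otimes> h) \<otimes> w"
      using F car that by (metis m_assoc subsetD)
    then show "d (\<phi> (f \<otimes> (h \<otimes> w)) u) (\<phi> (f \<otimes> (h \<otimes> w)) (x w)) \<le> c"
      using ux that \<open>f \<in> F\<close> by simp
  qed (use that car u insert.prems in auto)
  \<comment> \<open>The memory set sits at the identity, so \<open>x v\<close> and \<open>u\<close>
    are both translated by \<open>v\<close>. On \<open>B0 - A\<close> the translates are close
    because both points are close to \<open>y\<close> there: \<open>x v\<close> by hypothesis, and
    \<open>u\<close> by expansivity, since \<open>F\<close> times \<open>B0\<close> stays in
    \<open>B\<close> and \<open>B #> v\<close> avoids \<open>A <#> V\<close>.\<close>
  have "\<exists>z\<in>M. (\<forall>g\<in>B0. d (\<phi> g (\<phi> v (x v))) (\<phi> g z) \<le> \<epsilon>') \<and>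
      (\<forall>g\<in>carrier G - A. d (\<phi> g (\<phi> v u)) (\<phi> g z) \<le> \<epsilon>')"
  proof (rule mem)
    fix b assume b: "b \<in> B0 - A"
    have c: "b \<in> carrier G" "b \<otimes> v \<in> carrier G" using b AB car by auto
    have "d (\<phi> (b \<otimes> v) u) (\<phi> (b \<otimes> v) y) \<le> \<eta>"
    proof (rule local_close)
      fix f assume f: "f \<in> F"
      have "f \<otimes> (b \<otimes> v) = (f \<otimes> b) \<otimes> v" using f F c car by (metis m_assoc subsetD)
      moreover have "f \<otimes> b \<otimes> v \<notin> A <#> V"
        using FB0[of f b] f b \<open>v \<notin> V\<close> by (intro outside) auto
      moreover have "f \<otimes> b \<otimes> v \<in> carrier G" using f F c car by auto
      ultimately show "d (\<phi> (f \<otimes> (b \<otimes> v)) u) (\<phi> (f \<otimes> (b \<otimes> v)) y) \<le> c"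
        using uy[of "f \<otimes> b \<otimes> v"] bounds by auto
    qed (use c u \<open>y \<in> M\<close> in auto)
    moreover have "d (\<phi> (b \<otimes> v) (x v)) (\<phi> (b \<otimes> v) y) \<le> \<delta>"
      using insert.prems(5)[of v b] b sub by auto
    ultimately have "d (\<phi> (b \<otimes> v) (x v)) (\<phi> (b \<otimes> v) u) \<le> \<delta>'"
      using act_triangle[OF c(2) _ \<open>y \<in> M\<close> u, of "x v"] insert.prems(3) bounds
        commute[of "\<phi> (b \<otimes> v) y" "\<phi> (b \<otimes> v) u"] by force
    then show "d (\<phi> b (\<phi> v (x v))) (\<phi> b (\<phi> v u)) \<le> \<delta>'"
      using c car u insert.prems(3) by (simp add: composition_rule)
  qed (use car u insert.prems(3) act_closed in auto)
  then obtain z' where z': "z' \<in> M" "\<And>g. g \<in> B0 \<Longrightarrow> d (\<phi> g (\<phi> v (x v))) (\<phi> g z') \<le> \<epsilon>'"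
    "\<And>g. g \<in> carrier G - A \<Longrightarrow> d (\<phi> g (\<phi> v u)) (\<phi> g z') \<le> \<epsilon>'"
    by blast
  \<comment> \<open>\<open>z'\<close> is the glued point as seen from \<open>v\<close>;
    \<open>z\<close> undoes the translation.\<close>
  obtain z where z: "z \<in> M" "\<phi> v z = z'" using bij_prop1[OF car(1) z'(1)] by blast
  have zx: "d (\<phi> (b \<otimes> v) z) (\<phi> (b \<otimes> v) (x v)) \<le> \<epsilon>'" if "b \<in> B0" for b
    using z'(2)[OF that] z car AB(2) that insert.prems(3)
    by (simp add: composition_rule commute subset_iff)
  have zu: "d (\<phi> g z) (\<phi> g u) \<le> \<epsilon>'" if "g \<in> carrier G" "g \<notin> A <#> {v}" for g
  proof -
    have g: "g = (g \<otimes> inv v) \<otimes> v" using that car by (simp add: m_assoc)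
    then have "g \<otimes> inv v \<notin> A" using that unfolding set_mult_def by auto
    then have "d (\<phi> (g \<otimes> inv v) (\<phi> v u)) (\<phi> (g \<otimes> inv v) z') \<le> \<epsilon>'"
      using z'(3) that car by auto
    then have "d (\<phi> ((g \<otimes> inv v) \<otimes> v) u) (\<phi> ((g \<otimes> inv v) \<otimes> v) z) \<le> \<epsilon>'"
      using z u car that by (simp add: composition_rule del: m_assoc)
    then show ?thesis using g commute by metis
  qed
  show ?case
  proof (intro bexI[of _ z] conjI ballI)
    fix w a assume wa: "w \<in> insert v V" "a \<in> A"
    show "d (\<phi> (a \<otimes> w) z) (\<phi> (a \<otimes> w) (x w)) \<le> \<epsilon>' + \<eta>"
    proof (cases "w = v")
      case True
      then show ?thesis using zx[of a] wa AB bounds by auto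
    next
      case False
      then have w: "w \<in> V" "x w \<in> M" using wa insert.prems by auto
      have c: "a \<otimes> w \<in> carrier G" using w wa car by auto
      \<comment> \<open>Separation protects the earlier patches: \<open>z\<close> is
        \<open>\<epsilon>'\<close>-close to \<open>u\<close> here, and \<open>u\<close> is within
        \<open>\<eta>\<close> of \<open>x w\<close> instead of the inductive
        \<open>\<epsilon>' + \<eta>\<close>, so the error does not grow.\<close>
      have "a \<otimes> w \<notin> A <#> {v}"
        using disj[of a _ w v] False wa sub AB unfolding set_mult_def by auto
      moreover have "d (\<phi> (a \<otimes> w) u) (\<phi> (a \<otimes> w) (x w)) \<le> \<eta>"
        using w wa car FB0 AB by (intro ux') auto
      ultimately show ?thesis
        using act_triangle[OF c z(1) u w(2)] zu[OF c] by linarith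
    qed
  next
    fix g assume "g \<in> carrier G - (A <#> insert v V)"
    then have g: "g \<in> carrier G" "g \<notin> A <#> V" "g \<notin> A <#> {v}"
      unfolding set_mult_def by auto
    \<comment> \<open>The inductive bound \<open>\<epsilon>' + \<eta> + \<delta>\<close> leaves no
      room for another \<open>\<epsilon>'\<close>. If no \<open>F\<close>-translate of
      \<open>g\<close> meets \<open>A <#> V\<close>, expansivity improves it to
      \<open>\<eta>\<close>; otherwise \<open>g\<close> is near some patch and the comparison goes
      through \<open>x w\<close>.\<close>
    have "d (\<phi> g u) (\<phi> g y) \<le> \<eta> + \<delta>"
    proof (cases "\<exists>f\<in>F. f \<otimes> g \<in> A <#> V")
      case False
      have "d (\<phi> g u) (\<phi> g y) \<le> \<eta>"
      proof (rule local_close)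
        fix f assume "f \<in> F"
        then show "d (\<phi> (f \<otimes> g) u) (\<phi> (f \<otimes> g) y) \<le> c"
          using uy[of "f \<otimes> g"] False g F bounds by (auto simp: subset_iff)
      qed (use g u \<open>y \<in> M\<close> in auto)
      then show ?thesis using bounds by linarith
    next
      case True
      then obtain f a w where f: "f \<in> F" "a \<in> A" "w \<in> V" "f \<otimes> g = a \<otimes> w"
        unfolding set_mult_def by auto
      \<comment> \<open>\<open>g\<close> becomes \<open>h \<otimes> w\<close>, and
        \<open>FFA\<close> puts all \<open>F\<close>-translates of \<open>h\<close> into
        \<open>B\<close>, so \<open>u\<close> is \<open>\<eta>\<close>-close to \<open>x w\<close>
        at \<open>g\<close>. As \<open>g\<close> lies outside \<open>A <#> V\<close>,
        \<open>h\<close> is in \<open>B - A\<close>, where \<open>x w\<close> is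
        \<open>\<delta>\<close>-close to \<open>y\<close>.\<close>
      define h where "h = inv f \<otimes> a"
      have cf: "f \<in> carrier G" "a \<in> carrier G" "w \<in> carrier G" using f F car by auto
      then have h: "h \<in> carrier G" by (simp add: h_def)
      have gh: "g = h \<otimes> w"
        using f(4) cf g(1) by (metis h_def inv_closed inv_solve_left m_assoc m_closed)
      have hB: "f' \<otimes> h \<in> B" if "f' \<in> F" for f'
        using FFA that f by (simp add: h_def)
      then have "h \<in> B" using F(2) h by (metis l_one)
      moreover have "h \<notin> A" using g(2) gh f(3) unfolding set_mult_def by auto
      ultimately have "d (\<phi> g (x w)) (\<phi> g y) \<le> \<delta>"
        using insert.prems(5)[of w h] f gh by auto
      moreover have "d (\<phi> g u) (\<phi> g (x w)) \<le> \<eta>"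
        unfolding gh using f h hB by (intro ux') auto
      ultimately show ?thesis
        using act_triangle[OF g(1) u _ \<open>y \<in> M\<close>, of "x w"] insert.prems(3)[of w] f by auto
    qed
    then show "d (\<phi> g z) (\<phi> g y) \<le> \<epsilon>' + \<eta> + \<delta>"
      using act_triangle[OF g(1) z(1) u \<open>y \<in> M\<close>] zu[OF g(1,3)] by linarith
  qed (rule z)
qed

section \<open>Pointwise criteria for memory sets\<close>

lemma memory_set_iff:
  assumes "0 \<le> \<epsilon>" "0 \<le> \<delta>"
  shows "memory_set G M d \<phi> \<epsilon> \<delta> A B \<longleftrightarrow> finite B \<and> A \<subseteq> B \<and> B \<subseteq> carrier G \<and>
    (\<forall>x\<in>M. \<forall>y\<in>M. (\<forall>g\<in>B - A. d (\<phi> g x) (\<phi> g y) \<le> \<delta>) \<longrightarrow>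
      (\<exists>z\<in>M. (\<forall>g\<in>B. d (\<phi> g x) (\<phi> g z) \<le> \<epsilon>) \<and> (\<forall>g\<in>carrier G - A. d (\<phi> g y) (\<phi> g z) \<le> \<epsilon>)))"
proof (cases "B \<subseteq> carrier G")
  case True
  then have "B - A \<subseteq> carrier G" by auto
  with True assms show ?thesis
    unfolding memory_set_def by (simp add: dist_on_le_iff cong: conj_cong)
qed (simp add: memory_set_def)

text \<open>The plain memory-set condition is the case \<open>V = {\<one>}\<close> of gluing: a
  singleton is separated, and \<open>A <#> {\<one>} = A\<close>. Hence only gluing has to be
  checked.\<close>

lemma uniform_memory_setI:
  assumes "0 \<le> \<epsilon>" "0 \<le> \<delta>" "finite B" "A \<subseteq> B" "B \<subseteq> carrier G"
    and glue: "\<And>V x y. \<lbrakk>finite V; V \<subseteq> carrier G; separated G B V; \<And>v. v \<in> V \<Longrightarrow> x v \<in> M; y \<in> M;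
      \<And>v b. \<lbrakk>v \<in> V; b \<in> B - A\<rbrakk> \<Longrightarrow> d (\<phi> (b \<otimes> v) (x v)) (\<phi> (b \<otimes> v) y) \<le> \<delta>\<rbrakk> \<Longrightarrow>
      \<exists>z\<in>M. (\<forall>v\<in>V. \<forall>b\<in>B. d (\<phi> (b \<otimes> v) z) (\<phi> (b \<otimes> v) (x v)) \<le> \<epsilon>) \<and>
        (\<forall>g\<in>carrier G - (A <#> V). d (\<phi> g z) (\<phi> g y) \<le> \<epsilon>)"
  shows "uniform_memory_set G M d \<phi> \<epsilon> \<delta> A B"
  unfolding uniform_memory_set_def
proof (intro conjI allI impI)
  have A: "A <#> {\<one>} = A"
    using assms(4,5) by (metis coset_mult_one order_trans r_coset_eq_set_mult)
  show "memory_set G M d \<phi> \<epsilon> \<delta> A B"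
  proof (unfold memory_set_iff[OF assms(1,2)], intro conjI ballI impI)
    fix x y assume "x \<in> M" "y \<in> M" "\<forall>g\<in>B - A. d (\<phi> g x) (\<phi> g y) \<le> \<delta>"
    then have "\<exists>z\<in>M. (\<forall>v\<in>{\<one>}. \<forall>b\<in>B. d (\<phi> (b \<otimes> v) z) (\<phi> (b \<otimes> v) x) \<le> \<epsilon>) \<and>
        (\<forall>g\<in>carrier G - (A <#> {\<one>}). d (\<phi> g z) (\<phi> g y) \<le> \<epsilon>)"
      using subsetD[OF assms(5)] by (intro glue) (simp_all add: separated_def)
    then obtain z where "z \<in> M" "\<And>b. b \<in> B \<Longrightarrow> d (\<phi> (b \<otimes> \<one>) z) (\<phi> (b \<otimes> \<one>) x) \<le> \<epsilon>"
      "\<And>g. g \<in> carrier G - A \<Longrightarrow> d (\<phi> g z) (\<phi> g y) \<le> \<epsilon>"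
      unfolding A by blast
    then show "\<exists>z\<in>M. (\<forall>g\<in>B. d (\<phi> g x) (\<phi> g z) \<le> \<epsilon>) \<and> (\<forall>g\<in>carrier G - A. d (\<phi> g y) (\<phi> g z) \<le> \<epsilon>)"
      using commute r_one subsetD[OF assms(5)] by metis
  qed (use assms in auto)
next
  fix V x y
  assume *: "finite V \<and> V \<subseteq> carrier G \<and> separated G B V \<and> (\<forall>v\<in>V. x v \<in> M) \<and> y \<in> M \<and>
    (\<forall>v\<in>V. dist_on d \<phi> ((B - A) #> v) (x v) y \<le> \<delta>)"
  have sub: "(B - A) #> v \<subseteq> carrier G" "B #> v \<subseteq> carrier G" if "v \<in> V" for v
    using that * assms(5) by (auto simp: r_coset_def)
  have "d (\<phi> (b \<otimes> v) (x v)) (\<phi> (b \<otimes> v) y) \<le> \<delta>" if "v \<in> V" "b \<in> B - A" for v b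
  proof -
    have "b \<otimes> v \<in> (B - A) #> v" using that by (auto simp: r_coset_def)
    then show ?thesis using that(1) * dist_on_le_iff[OF sub(1)] assms(2) by blast
  qed
  then obtain z where z: "z \<in> M" "\<And>v b. \<lbrakk>v \<in> V; b \<in> B\<rbrakk> \<Longrightarrow> d (\<phi> (b \<otimes> v) z) (\<phi> (b \<otimes> v) (x v)) \<le> \<epsilon>"
    "\<And>g. g \<in> carrier G - (A <#> V) \<Longrightarrow> d (\<phi> g z) (\<phi> g y) \<le> \<epsilon>"
    using glue[of V x y] * by blast
  show "\<exists>z\<in>M. (\<forall>v\<in>V. dist_on d \<phi> (B #> v) z (x v) \<le> \<epsilon>) \<and>
    dist_on d \<phi> (carrier G - (A <#> V)) z y \<le> \<epsilon>"
  proof (intro bexI[of _ z] conjI ballI)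
    show "dist_on d \<phi> (B #> v) z (x v) \<le> \<epsilon>" if "v \<in> V" for v
      using that * z assms(1) by (subst dist_on_le_iff[OF sub(2)]) (auto simp: r_coset_def)
    show "dist_on d \<phi> (carrier G - (A <#> V)) z y \<le> \<epsilon>"
      using * z assms(1) by (subst dist_on_le_iff) auto
  qed (rule z)
qed

section \<open>Choice of constants and the enlarged memory set\<close>

text \<open>The order of choices matters: \<open>\<epsilon>'\<close>, \<open>\<delta>'\<close>,
  \<open>\<eta>\<close> and \<open>F\<close> are fixed before \<open>A\<close>, and only
  \<open>B0\<close> and \<open>B\<close> depend on it. Thus \<open>\<eta>\<close> serves as the
  \<open>\<delta>\<close> for every finite \<open>A\<close>.\<close>

theorem expansive_Markov_imp_uniform_Markov:
  assumes "expansive G M d \<phi>" and tmp: "topological_Markov_property G M d \<phi>"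
  shows "uniform_topological_Markov_property G M d \<phi>"
  unfolding uniform_topological_Markov_property_def
proof (intro allI impI)
  fix \<epsilon> :: real assume "0 < \<epsilon>"
  obtain c where "0 < c" and
    c: "\<And>x y. \<lbrakk>x \<in> M; y \<in> M; x \<noteq> y\<rbrakk> \<Longrightarrow> \<exists>g\<in>carrier G. c < d (\<phi> g x) (\<phi> g y)"
    using assms(1) unfolding expansive_def by blast
  \<comment> \<open>The quarter makes room, below both \<open>\<epsilon>\<close> and
    \<open>c\<close>, for \<open>\<epsilon>'\<close> and three errors
    \<open>\<eta> \<le> \<epsilon>'\<close>: one from expansivity and two from the closeness
    hypothesis.\<close>
  define \<epsilon>' where "\<epsilon>' = min \<epsilon> c / 4"
  have "0 < \<epsilon>'" using \<open>0 < \<epsilon>\<close> \<open>0 < c\<close> by (simp add: \<epsilon>'_def)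
  obtain \<delta>' where "0 < \<delta>'" and
    \<delta>': "\<And>A. \<lbrakk>finite A; A \<subseteq> carrier G\<rbrakk> \<Longrightarrow> \<exists>B. memory_set G M d \<phi> \<epsilon>' \<delta>' A B"
    using tmp[unfolded topological_Markov_property_def, rule_format, OF \<open>0 < \<epsilon>'\<close>] by blast
  \<comment> \<open>\<open>\<eta>\<close> is both the precision gained from expansivity and the
    final \<open>\<delta>\<close>; halving \<open>\<delta>'\<close> lets the two add up to at most
    \<open>\<delta>'\<close>.\<close>
  define \<eta> where "\<eta> = min \<epsilon>' (\<delta>' / 2)"
  have "0 < \<eta>" using \<open>0 < \<epsilon>'\<close> \<open>0 < \<delta>'\<close> by (simp add: \<eta>_def)
  have bounds: "\<eta> + \<eta> \<le> \<delta>'" "\<epsilon>' + \<eta> + 2 * \<eta> \<le> c" "\<epsilon>' + \<eta> + 2 * \<eta> \<le> \<epsilon>"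
    unfolding \<eta>_def \<epsilon>'_def using \<open>0 < \<epsilon>\<close> \<open>0 < c\<close> by (simp_all add: min_def)
  have "\<exists>F. finite F \<and> F \<subseteq> carrier G \<and> \<one> \<in> F \<and>
      (\<forall>x\<in>M. \<forall>y\<in>M. (\<forall>f\<in>F. d (\<phi> f x) (\<phi> f y) \<le> c) \<longrightarrow> d x y \<le> \<eta>)"
    by (rule expansive_finite) (fact c \<open>0 < \<eta>\<close>)+
  then obtain F where F: "finite F" "F \<subseteq> carrier G" "\<one> \<in> F" and
    F': "\<forall>x\<in>M. \<forall>y\<in>M. (\<forall>f\<in>F. d (\<phi> f x) (\<phi> f y) \<le> c) \<longrightarrow> d x y \<le> \<eta>"
    by blast
  have expand: "d x y \<le> \<eta>"
    if "x \<in> M" "y \<in> M" "\<And>f. f \<in> F \<Longrightarrow> d (\<phi> f x) (\<phi> f y) \<le> c" for x y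
    using F' that by blast
  have "\<exists>B. uniform_memory_set G M d \<phi> \<epsilon> \<eta> A B" if A: "finite A" "A \<subseteq> carrier G" for A
  proof -
    obtain B0 where "memory_set G M d \<phi> \<epsilon>' \<delta>' A B0" using \<delta>' A by blast
    note mem0 = this[unfolded memory_set_iff[OF less_imp_le[OF \<open>0 < \<epsilon>'\<close>] less_imp_le[OF \<open>0 < \<delta>'\<close>]]]
    then have B0: "finite B0" "A \<subseteq> B0" "B0 \<subseteq> carrier G" by blast+
    have mem: "\<exists>z\<in>M. (\<forall>g\<in>B0. d (\<phi> g x) (\<phi> g z) \<le> \<epsilon>') \<and> (\<forall>g\<in>carrier G - A. d (\<phi> g y) (\<phi> g z) \<le> \<epsilon>')"
      if "x \<in> M" "y \<in> M" "\<And>g. g \<in> B0 - A \<Longrightarrow> d (\<phi> g x) (\<phi> g y) \<le> \<delta>'" for x y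
      using mem0 that by blast
    \<comment> \<open>The first part gives room for expansivity around \<open>B0\<close>, the second
      around points with an \<open>F\<close>-translate in \<open>A\<close>.\<close>
    define B where "B = (F <#> B0) \<union> (F <#> (m_inv G ` F <#> A))"
    have fin: "finite (K <#> L)" if "finite K" "finite L" for K L
      using that by (auto simp: set_mult_def)
    have "finite B"
      unfolding B_def using F(1) A(1) B0(1) by (intro finite_UnI fin finite_imageI)
    moreover have "m_inv G ` F \<subseteq> carrier G"
      using F(2) by auto
    then have "B \<subseteq> carrier G"
      unfolding B_def using F(2) A(2) B0(3) by (intro Un_least set_mult_closed)
    ultimately have B: "finite B" "B \<subseteq> carrier G" .
    have smult: "k \<otimes> l \<in> K <#> L" if "k \<in> K" "l \<in> L" for k l K L
      using that unfolding set_mult_def by blast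
    have FB0: "f \<otimes> b \<in> B" if "f \<in> F" "b \<in> B0" for f b
      unfolding B_def using that by (intro UnI1 smult)
    have FFA: "f \<otimes> (inv f' \<otimes> a) \<in> B" if "f \<in> F" "f' \<in> F" "a \<in> A" for f f' a
      unfolding B_def using that by (intro UnI2 smult imageI)
    have "A \<subseteq> B"
      using FB0[OF F(3)] B0(2,3) by (metis l_one subset_iff)
    have "uniform_memory_set G M d \<phi> \<epsilon> \<eta> A B"
    proof (rule uniform_memory_setI)
      fix V x y
      assume V: "finite V" "V \<subseteq> carrier G" "separated G B V"
        and xy: "\<And>v. v \<in> V \<Longrightarrow> x v \<in> M" "y \<in> M"
        and close: "\<And>v b. \<lbrakk>v \<in> V; b \<in> B - A\<rbrakk> \<Longrightarrow> d (\<phi> (b \<otimes> v) (x v)) (\<phi> (b \<otimes> v) y) \<le> \<eta>"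
      have "\<exists>z\<in>M. (\<forall>v\<in>V. \<forall>a\<in>A. d (\<phi> (a \<otimes> v) z) (\<phi> (a \<otimes> v) (x v)) \<le> \<epsilon>' + \<eta>) \<and>
          (\<forall>g\<in>carrier G - (A <#> V). d (\<phi> g z) (\<phi> g y) \<le> \<epsilon>' + \<eta> + \<eta>)"
        by (rule glue_along_separated[where F = F and B = B and ?B0.0 = B0 and c = c and \<delta>' = \<delta>'])
          (fact F expand mem B0 B FB0 FFA bounds V xy close
            less_imp_le[OF \<open>0 < \<eta>\<close>] less_imp_le[OF \<open>0 < \<epsilon>'\<close>])+
      then obtain z where z: "z \<in> M"
        "\<And>v a. \<lbrakk>v \<in> V; a \<in> A\<rbrakk> \<Longrightarrow> d (\<phi> (a \<otimes> v) z) (\<phi> (a \<otimes> v) (x v)) \<le> \<epsilon>' + \<eta>"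
        "\<And>g. g \<in> carrier G - (A <#> V) \<Longrightarrow> d (\<phi> g z) (\<phi> g y) \<le> \<epsilon>' + \<eta> + \<eta>"
        by blast
      \<comment> \<open>Gluing controls \<open>A\<close> directly. For \<open>b\<close> in
        \<open>B - A\<close>, separation puts \<open>b \<otimes> v\<close> outside
        \<open>A <#> V\<close>, and passing through \<open>y\<close> costs one more
        \<open>\<eta>\<close>.\<close>
      have "d (\<phi> (b \<otimes> v) z) (\<phi> (b \<otimes> v) (x v)) \<le> \<epsilon>" if "v \<in> V" "b \<in> B" for v b
      proof (cases "b \<in> A")
        case True
        then show ?thesis using z(2)[OF that(1) True] bounds \<open>0 < \<eta>\<close> by linarith
      next
        case False
        have c: "b \<otimes> v \<in> carrier G" using that V B by auto
        have "b \<otimes> v \<notin> A <#> V"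
        proof
          assume "b \<otimes> v \<in> A <#> V"
          then obtain a w where aw: "a \<in> A" "w \<in> V" "b \<otimes> v = a \<otimes> w"
            unfolding set_mult_def by auto
          then have "v = w"
            using V(3) that \<open>A \<subseteq> B\<close> unfolding separated_def r_coset_def by blast
          then show False
            using aw False that V(2) B(2) A(2) by (metis right_cancel subsetD)
        qed
        then show ?thesis
          using act_triangle[OF c z(1) xy(2) xy(1)[OF that(1)]] z(3)[of "b \<otimes> v"] c bounds
            close[of v b] that False commute[of "\<phi> (b \<otimes> v) y" "\<phi> (b \<otimes> v) (x v)"] by force
      qed
      moreover have "d (\<phi> g z) (\<phi> g y) \<le> \<epsilon>" if "g \<in> carrier G - (A <#> V)" for g
        using z(3)[OF that] bounds(3) \<open>0 < \<eta>\<close> by linarith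
      ultimately show "\<exists>z\<in>M. (\<forall>v\<in>V. \<forall>b\<in>B. d (\<phi> (b \<otimes> v) z) (\<phi> (b \<otimes> v) (x v)) \<le> \<epsilon>) \<and>
          (\<forall>g\<in>carrier G - (A <#> V). d (\<phi> g z) (\<phi> g y) \<le> \<epsilon>)"
        using z(1) by blast
    qed (use \<open>0 < \<epsilon>\<close> \<open>0 < \<eta>\<close> B \<open>A \<subseteq> B\<close> in auto)
    then show ?thesis by blast
  qed
  with \<open>0 < \<eta>\<close> show "\<exists>\<delta>>0. \<forall>A. finite A \<and> A \<subseteq> carrier G \<longrightarrow>
      (\<exists>B. uniform_memory_set G M d \<phi> \<epsilon> \<delta> A B)"
    by blast
qed

end

theorem theorem3p13:
  fixes G :: "('g, 'b) monoid_scheme"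
    and X :: "'x topology"
    and d :: "'x \<Rightarrow> 'x \<Rightarrow> real"
    and \<phi> :: "'g \<Rightarrow> 'x \<Rightarrow> 'x"
  assumes "group G" and "countable (carrier G)" and "infinite (carrier G)"
    and "compact_space X"
    and "Metric_space (topspace X) d" and "Metric_space.mtopology (topspace X) d = X"
    and "group_action G (topspace X) \<phi>"
    and "\<And>g. g \<in> carrier G \<Longrightarrow> homeomorphic_map X X (\<phi> g)"
    and "expansive G (topspace X) d \<phi>"
    and "topological_Markov_property G (topspace X) d \<phi>"
  shows "uniform_topological_Markov_property G (topspace X) d \<phi>"
proof -
  have "compact_metric_action G (topspace X) \<phi> d"
    unfolding compact_metric_action_def compact_metric_action_axioms_def
    using assms by (simp add: homeomorphic_imp_continuous_map)
  then show ?thesis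
    using assms(9,10) by (rule compact_metric_action.expansive_Markov_imp_uniform_Markov)
qed

end
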